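(* Consider the i.i.d. mixture model $\mathbf P^{(m)}_{\pi_0,G}$ of $m$ independent $p$-values with proportion of nulls $\pi_0$ and marginal c.d.f., independent of $m$, given by $F(t)=\pi_0t+(1-\pi_0)G(t)$, where $G$ is the c.d.f. of an (alternative) distribution having a continuous decreasing density $g$ on $[0,1]$ (so that $g(0)>1$). If $\alpha,\delta$ are such that $$0<\delta<\frac1{\pi_0+(1-\pi_0)g(0)}<\alpha<1,$$ then the Simes-based closed testing bound at level $\delta$ is not $\mathrm{BH}(\alpha)$-$m$-consistent in the model $\mathbf P^{(m)}_{\pi_0,G}$, whereas the bounds $$\overline{\mathrm{FDP}}^{\mathrm{DKW}}_\alpha=\mathbf 1\{\hat k_\alpha\ge1\}\wedge\left(\alpha+\frac{m^{1/2}\sqrt{0.5\log(1/\delta)}}{1\vee\hat k_\alpha}\right)$$ and $$\overline{\mathrm{FDP}}^{\mathrm{Well}}_\alpha=\mathbf 1\{\hat k_\alpha\ge1\}\wedge\left(\alpha\,h^{-1}\!\left(\frac{2\log(\kappa/\delta)+4\log\Bigl(1+\log_2\bigl(\tfrac{m}{\alpha(1\vee\hat k_\alpha)}\bigr)\Bigr)}{\alpha(1\vee\hat k_\alpha)}\right)\right),\qquad\kappa=\pi^2/6,$$ are $\mathrm{BH}(\alpha)$-$m$-consistent in that model.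
   Context: Two-group model $\mathbf P^{(m)}_{\pi_0,G}$, $\pi_0\in(0,1)$: independently for each $i\in\{1,\dots,m\}$, hypothesis $i$ is a true null with probability $\pi_0$, in which case $p_i\sim U(0,1)$, and otherwise $p_i\sim G$; so $p_1,\dots,p_m$ are i.i.d. with c.d.f. $F$. With ordered $p$-values $p_{(1)}\le\dots\le p_{(m)}$, the procedure $\mathrm{BH}(\alpha)$ has $\hat k_\alpha=\max\{k\in\{1,\dots,m\}:mp_{(k)}/k\le\alpha\}$ rejections ($0$ if the set is empty) and rejection set $R=\{i:p_i\le p_{(\hat k_\alpha)}\}$ ($\emptyset$ if $\hat k_\alpha=0$). Simes-based closed testing bound at level $\delta$: for nonempty $I\subset\{1,\dots,m\}$, with $p_{(1:I)}\le\dots\le p_{(|I|:I)}$ the ordered $p$-values $(p_i)_{i\in I}$, the local Simes test rejects $I$ if $p_{(i:I)}\le\delta i/|I|$ for some $1\le i\le|I|$; the closed testing procedure rejects $I$ if every $J$ with $I\subset J\subset\{1,\dots,m\}$ is rejected by its local test. The bound for the number of false positives in $R$ is $\max\{|I|: I\subset R,\ I\text{ not rejected by the closed testing procedure}\}$ (with $\emptyset$ never rejected), and the FDP bound on $R$ is this number divided by $|R|\vee1$. A bound $\overline{\mathrm{FDP}}_\alpha$ for the FDP of the $\mathrm{BH}(\alpha)$ rejection set is $\mathrm{BH}(\alpha)$-$m$-consistent if for all $\epsilon>0$, $\lim_{m\to\infty}\mathbf P^{(m)}_{\pi_0,G}(\overline{\mathrm{FDP}}_\alpha-\alpha\ge\epsilon)=0$.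 The function $h(\lambda)=\lambda(\log\lambda-1)+1$, $\lambda>1$, is an increasing bijection $(1,\infty)\to(0,\infty)$ with inverse $h^{-1}$. *)

theory Defs
  imports "HOL-Probability.Probability"
begin

subsection \<open>The two-group model\<close>

text \<open>One coordinate is a pair \<open>(H, p)\<close>, where \<open>H\<close> means that the hypothesis is a true null.
  The alternative distribution is given by its law \<open>G\<close>; its distribution function is \<open>cdf G\<close>.\<close>

definition two_group_coord :: "real \<Rightarrow> real measure \<Rightarrow> (bool \<times> real) measure" where
  "two_group_coord \<pi>\<^sub>0 G =
     measure_pmf (bernoulli_pmf \<pi>\<^sub>0) \<bind>
       (\<lambda>H. distr (if H then uniform_measure lborel {0..1} else G)
               (count_space UNIV \<Otimes>\<^sub>M borel) (\<lambda>x. (H, x)))"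

definition two_group_model :: "real \<Rightarrow> real measure \<Rightarrow> nat \<Rightarrow> (nat \<Rightarrow> bool \<times> real) measure" where
  "two_group_model \<pi>\<^sub>0 G m = PiM {1..m} (\<lambda>_. two_group_coord \<pi>\<^sub>0 G)"

definition pvals :: "(nat \<Rightarrow> bool \<times> real) \<Rightarrow> nat \<Rightarrow> real" where
  "pvals \<omega> i = snd (\<omega> i)"

lemma cdf_two_group_coord:
  assumes "real_distribution G" and "\<pi>\<^sub>0 \<in> {0<..<1}" and "t \<in> {0..1}"
  shows "cdf (distr (two_group_coord \<pi>\<^sub>0 G) borel snd) t = \<pi>\<^sub>0 * t + (1 - \<pi>\<^sub>0) * cdf G t"
proof -
  interpret G: real_distribution G by fact
  let ?U = "uniform_measure lborel {0..1::real}"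
  let ?K = "count_space (UNIV :: bool set) \<Otimes>\<^sub>M (borel :: real measure)"
  let ?N = "\<lambda>H::bool. distr (if H then ?U else G) ?K (\<lambda>x. (H, x))"
  let ?S = "snd -` {..t} \<inter> space ?K"
  have U: "prob_space ?U" by (intro prob_space_uniform_measure) auto
  have mU: "(\<lambda>x. (H, x)) \<in> measurable (if H then ?U else G) ?K" for H :: bool
    by (cases H) (auto intro!: measurable_Pair simp: measurable_cong_sets[of ?U borel ?K ?K]
        measurable_cong_sets[of G borel ?K ?K])
  have pN: "prob_space (?N H)" for H
    using mU[of H] U G.prob_space_axioms
    by (intro prob_space.prob_space_distr[OF _ mU]) (cases H; simp)
  have N: "?N \<in> measurable (measure_pmf (bernoulli_pmf \<pi>\<^sub>0)) (subprob_algebra ?K)"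
    using pN by (auto simp add: space_subprob_algebra simp del: if_split intro!: prob_space_imp_subprob_space)
  have S: "?S \<in> sets ?K" by (rule measurable_sets[of snd _ borel]) auto
  have sN: "sets (two_group_coord \<pi>\<^sub>0 G) = sets ?K"
    unfolding two_group_coord_def by (rule sets_bind[of _ _ ?K]) auto
  have snd: "snd \<in> measurable (two_group_coord \<pi>\<^sub>0 G) borel"
    using sN by (simp cong: measurable_cong_sets)
  have e: "emeasure (?N H) ?S = emeasure (if H then ?U else G) {..t}" for H
  proof -
    have "(\<lambda>x. (H, x)) -` ?S \<inter> space (if H then ?U else G) = {..t}"
      by (auto simp: space_pair_measure)
    then show ?thesis using emeasure_distr[OF mU S, of H] by presburger
  qed
  have eU: "emeasure ?U {..t} = ennreal t"
  proof -
    have "{0..1} \<inter> {..t} = {0..t}" using assms(3) by auto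
    then show ?thesis using assms(3) by (simp add: emeasure_uniform_measure divide_ennreal_def)
  qed
  have "emeasure (two_group_coord \<pi>\<^sub>0 G) ?S = ennreal \<pi>\<^sub>0 * ennreal t + ennreal (1 - \<pi>\<^sub>0) * emeasure G {..t}"
    unfolding two_group_coord_def
    by (subst emeasure_bind[OF _ N S]) (use assms in \<open>simp_all add: e eU mult.commute del: emeasure_uniform_measure\<close>)
  also have "\<dots> = ennreal (\<pi>\<^sub>0 * t + (1 - \<pi>\<^sub>0) * cdf G t)"
    using assms by (simp add: cdf_def G.emeasure_eq_measure ennreal_mult ennreal_plus)
  finally have "measure (two_group_coord \<pi>\<^sub>0 G) ?S = \<pi>\<^sub>0 * t + (1 - \<pi>\<^sub>0) * cdf G t"
    using assms by (auto intro!: measure_eq_emeasure_eq_ennreal add_nonneg_nonneg mult_nonneg_nonneg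
        simp: cdf_def)
  then show ?thesis
    using snd sets_eq_imp_space_eq[OF sN] by (simp add: cdf_def measure_distr)
qed

subsection \<open>The Benjamini--Hochberg procedure\<close>

text \<open>\<open>order_stat p I k\<close> is the \<open>k\<close>-th smallest of \<open>(p i)\<close>, \<open>i \<in> I\<close>, for \<open>k\<close> from 1 to \<open>card I\<close>.\<close>

definition order_stat :: "(nat \<Rightarrow> real) \<Rightarrow> nat set \<Rightarrow> nat \<Rightarrow> real" where
  "order_stat p I k = sort (map p (sorted_list_of_set I)) ! (k - 1)"

definition bh_count :: "real \<Rightarrow> nat \<Rightarrow> (nat \<Rightarrow> real) \<Rightarrow> nat" where
  "bh_count \<alpha> m p =
     (let K = {k \<in> {1..m}. real m * order_stat p {1..m} k / real k \<le> \<alpha>}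
      in if K = {} then 0 else Max K)"

definition bh_set :: "real \<Rightarrow> nat \<Rightarrow> (nat \<Rightarrow> real) \<Rightarrow> nat set" where
  "bh_set \<alpha> m p =
     (if bh_count \<alpha> m p = 0 then {}
      else {i \<in> {1..m}. p i \<le> order_stat p {1..m} (bh_count \<alpha> m p)})"

subsection \<open>Bounds on the false discovery proportion\<close>

definition simes_rejects :: "real \<Rightarrow> (nat \<Rightarrow> real) \<Rightarrow> nat set \<Rightarrow> bool" where
  "simes_rejects \<delta> p I \<longleftrightarrow> (\<exists>i \<in> {1..card I}. order_stat p I i \<le> \<delta> * real i / real (card I))"

definition closed_rejects :: "real \<Rightarrow> nat \<Rightarrow> (nat \<Rightarrow> real) \<Rightarrow> nat set \<Rightarrow> bool" where
  "closed_rejects \<delta> m p I \<longleftrightarrow>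
     I \<noteq> {} \<and> (\<forall>J. I \<subseteq> J \<and> J \<subseteq> {1..m} \<longrightarrow> simes_rejects \<delta> p J)"

definition simes_fp_bound :: "real \<Rightarrow> nat \<Rightarrow> (nat \<Rightarrow> real) \<Rightarrow> nat set \<Rightarrow> nat" where
  "simes_fp_bound \<delta> m p R = Max {card I |I. I \<subseteq> R \<and> \<not> closed_rejects \<delta> m p I}"

definition simes_fdp_bound :: "real \<Rightarrow> real \<Rightarrow> nat \<Rightarrow> (nat \<Rightarrow> real) \<Rightarrow> real" where
  "simes_fdp_bound \<alpha> \<delta> m p =
     real (simes_fp_bound \<delta> m p (bh_set \<alpha> m p)) / real (max (card (bh_set \<alpha> m p)) 1)"

definition dkw_fdp_bound :: "real \<Rightarrow> real \<Rightarrow> nat \<Rightarrow> (nat \<Rightarrow> real) \<Rightarrow> real" where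
  "dkw_fdp_bound \<alpha> \<delta> m p =
     (let k = bh_count \<alpha> m p
      in min (of_bool (k \<ge> 1))
             (\<alpha> + sqrt (real m) * sqrt (0.5 * ln (1 / \<delta>)) / real (max 1 k)))"

definition h_fun :: "real \<Rightarrow> real" where
  "h_fun x = x * (ln x - 1) + 1"

definition h_inv :: "real \<Rightarrow> real" where
  "h_inv = inv_into {1<..} h_fun"

definition well_fdp_bound :: "real \<Rightarrow> real \<Rightarrow> nat \<Rightarrow> (nat \<Rightarrow> real) \<Rightarrow> real" where
  "well_fdp_bound \<alpha> \<delta> m p =
     (let k = bh_count \<alpha> m p; \<kappa> = pi\<^sup>2 / 6
      in min (of_bool (k \<ge> 1))
             (\<alpha> * h_inv ((2 * ln (\<kappa> / \<delta>)
                            + 4 * ln (1 + log 2 (real m / (\<alpha> * real (max 1 k)))))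
                          / (\<alpha> * real (max 1 k)))))"

subsection \<open>Consistency\<close>

text \<open>A bound is a function of the number \<open>m\<close> of hypotheses and of the \<open>p\<close>-values.\<close>

definition bh_m_consistent ::
  "real \<Rightarrow> real measure \<Rightarrow> real \<Rightarrow> (nat \<Rightarrow> (nat \<Rightarrow> real) \<Rightarrow> real) \<Rightarrow> bool" where
  "bh_m_consistent \<pi>\<^sub>0 G \<alpha> B \<longleftrightarrow>
     (\<forall>\<epsilon>>0. (\<lambda>m. measure (two_group_model \<pi>\<^sub>0 G m)
                   {\<omega> \<in> space (two_group_model \<pi>\<^sub>0 G m). B m (pvals \<omega>) - \<alpha> \<ge> \<epsilon>})
             \<longlonglongrightarrow> 0)"

end

theory Submission
  imports Defs "HOL-Real_Asymp.Real_Asymp"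
begin

text \<open>
  Let \<open>a = \<pi>\<^sub>0 + (1 - \<pi>\<^sub>0) g(0)\<close> be the slope of \<open>F\<close> at \<open>0\<close>, so that \<open>F(t) \<le> a t\<close>.

  If the Simes test does not reject the full set \<open>{1..m}\<close>, closed testing rejects nothing and the
  bound equals \<open>1\<close> as soon as BH rejects something. The Simes test rejects the full set exactly when
  \<open>BH(\<delta>)\<close> makes a rejection, and by Simes' inequality for variables with \<open>F(t) \<le> a t\<close> this has
  probability at most \<open>a \<delta> < 1\<close>. The inequality follows from the leave-one-out argument: when BH rejects
  \<open>i\<close>, replacing \<open>p\<^sub>i\<close> by \<open>0\<close> does not change the number of rejections, which then is independent
  of \<open>p\<^sub>i\<close>.

  Since \<open>a \<alpha> > 1\<close>, some \<open>t > 0\<close> has \<open>F(t) > t / \<alpha>\<close>, and Hoeffding's inequality shows that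
  \<open>BH(\<alpha>)\<close> rejects more than \<open>m t / \<alpha>\<close> hypotheses with probability tending to \<open>1\<close>. On this event
  the excesses of the two other bounds over \<open>\<alpha>\<close> are at most a deterministic null sequence.
\<close>

section \<open>Order statistics and the Benjamini--Hochberg procedure\<close>

text \<open>In a sorted list the entries at most \<open>t\<close> form an initial segment. Indices
  start at 0, hence the strict inequality on the right.\<close>

lemma sorted_nth_le_iff_length_filter:
  fixes xs :: "'a::linorder list"
  assumes "sorted xs" "n < length xs"
  shows "xs ! n \<le> t \<longleftrightarrow> n < length (filter (\<lambda>x. x \<le> t) xs)"
  using assms
proof (induction xs arbitrary: n)
  case (Cons x xs)
  show ?case
  proof (cases "x \<le> t")
    case True
    then show ?thesis using Cons by (cases n) auto
  next
    case False
    then have less: "\<not> y \<le> t" if "y \<in> set (x # xs)" for y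
      using Cons.prems(1) that by auto
    have "filter (\<lambda>x. x \<le> t) (x # xs) = []"
      unfolding filter_empty_conv using less by blast
    moreover have "\<not> (x # xs) ! n \<le> t"
      using less nth_mem[OF Cons.prems(2)] by blast
    ultimately show ?thesis by (simp only: list.size not_less0)
  qed
qed simp

text \<open>Translates order statistics into counts of p-values below a threshold. Counts are sums
  of indicators and monotone in the threshold, so the later arguments about BH and Simes use them
  instead.\<close>

lemma order_stat_le_iff:
  assumes "finite I" "1 \<le> k" "k \<le> card I"
  shows "order_stat p I k \<le> t \<longleftrightarrow> k \<le> card {i \<in> I. p i \<le> t}"
proof -
  let ?l = "sorted_list_of_set I"
  have "length (filter (\<lambda>x. x \<le> t) (sort (map p ?l))) = length (filter (\<lambda>i. p i \<le> t) ?l)"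
    by (simp add: filter_sort filter_map comp_def)
  also have "\<dots> = card (set (filter (\<lambda>i. p i \<le> t) ?l))"
    by (rule distinct_card[symmetric]) simp
  also have "set (filter (\<lambda>i. p i \<le> t) ?l) = {i \<in> I. p i \<le> t}"
    using assms by auto
  finally have "length (filter (\<lambda>x. x \<le> t) (sort (map p ?l))) = card {i \<in> I. p i \<le> t}" .
  then show ?thesis
    using sorted_nth_le_iff_length_filter[of "sort (map p ?l)" "k - 1" t] assms
    by (auto simp: order_stat_def)
qed

lemma bh_condition_iff:
  assumes "k \<in> {1..m}"
  shows "real m * order_stat p {1..m} k / real k \<le> \<alpha>
    \<longleftrightarrow> k \<le> card {i \<in> {1..m}. p i \<le> \<alpha> * real k / real m}"
proof -
  have "real m * order_stat p {1..m} k / real k \<le> \<alpha> \<longleftrightarrow> order_stat p {1..m} k \<le> \<alpha> * real k / real m"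
    using assms by (auto simp: field_simps)
  then show ?thesis
    using assms by (simp add: order_stat_le_iff)
qed

lemma bh_count_eq:
  "bh_count \<alpha> m p =
     (let K = {k \<in> {1..m}. k \<le> card {i \<in> {1..m}. p i \<le> \<alpha> * real k / real m}}
      in if K = {} then 0 else Max K)"
proof -
  have "{k \<in> {1..m}. real m * order_stat p {1..m} k / real k \<le> \<alpha>} =
      {k \<in> {1..m}. k \<le> card {i \<in> {1..m}. p i \<le> \<alpha> * real k / real m}}"
    using bh_condition_iff by blast
  then show ?thesis
    unfolding bh_count_def by simp
qed

lemma le_bh_count:
  assumes "k \<le> m" "k \<le> card {i \<in> {1..m}. p i \<le> \<alpha> * real k / real m}"
  shows "k \<le> bh_count \<alpha> m p"
proof (cases "k = 0")
  case False
  then have "k \<in> {k \<in> {1..m}. k \<le> card {i \<in> {1..m}. p i \<le> \<alpha> * real k / real m}}"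
    using assms by auto
  then show ?thesis
    unfolding bh_count_eq Let_def by (auto intro!: Max_ge)
qed simp

lemma bh_count_props:
  shows bh_count_le: "bh_count \<alpha> m p \<le> m"
    and bh_count_le_card:
      "bh_count \<alpha> m p \<le> card {i \<in> {1..m}. p i \<le> \<alpha> * real (bh_count \<alpha> m p) / real m}"
proof -
  let ?K = "{k \<in> {1..m}. k \<le> card {i \<in> {1..m}. p i \<le> \<alpha> * real k / real m}}"
  \<comment> \<open>The default value 0 for an empty set of candidates satisfies both inequalities
    trivially.\<close>
  have "bh_count \<alpha> m p = 0 \<or> bh_count \<alpha> m p \<in> ?K"
    unfolding bh_count_eq Let_def using Max_in[of ?K] by auto
  then show "bh_count \<alpha> m p \<le> m"
    "bh_count \<alpha> m p \<le> card {i \<in> {1..m}. p i \<le> \<alpha> * real (bh_count \<alpha> m p) / real m}"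
    by auto
qed

text \<open>Characterises the value without \<open>Max\<close>, by count conditions at indices
  \<open>k \<ge> n\<close> only. This gives measurability, and shows that counts at smaller indices
  are irrelevant, which the leave-one-out argument exploits.\<close>

lemma bh_count_eq_iff:
  "bh_count \<alpha> m p = n \<longleftrightarrow> n \<le> m \<and>
     n \<le> card {i \<in> {1..m}. p i \<le> \<alpha> * real n / real m} \<and>
     (\<forall>k \<in> {n<..m}. \<not> k \<le> card {i \<in> {1..m}. p i \<le> \<alpha> * real k / real m})"
proof
  assume "bh_count \<alpha> m p = n"
  then show "n \<le> m \<and> n \<le> card {i \<in> {1..m}. p i \<le> \<alpha> * real n / real m} \<and>
     (\<forall>k \<in> {n<..m}. \<not> k \<le> card {i \<in> {1..m}. p i \<le> \<alpha> * real k / real m})"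
    using bh_count_props[of \<alpha> m p] le_bh_count[of _ m p \<alpha>]
    by (metis greaterThanAtMost_iff leD)
next
  assume "n \<le> m \<and> n \<le> card {i \<in> {1..m}. p i \<le> \<alpha> * real n / real m} \<and>
     (\<forall>k \<in> {n<..m}. \<not> k \<le> card {i \<in> {1..m}. p i \<le> \<alpha> * real k / real m})"
  then show "bh_count \<alpha> m p = n"
    using bh_count_props[of \<alpha> m p] le_bh_count[of n m p \<alpha>]
    by (metis greaterThanAtMost_iff le_neq_implies_less)
qed

text \<open>If more than \<open>R\<close> p-values lay below the threshold belonging to
  \<open>R = bh_count \<alpha> m p\<close>, then \<open>R + 1\<close> would satisfy the BH condition
  too, since its threshold is no smaller. This contradicts maximality.\<close>

lemma card_bh_threshold:
  assumes "0 \<le> \<alpha>"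
  shows "card {i \<in> {1..m}. p i \<le> \<alpha> * real (bh_count \<alpha> m p) / real m} = bh_count \<alpha> m p"
proof (rule ccontr)
  let ?R = "bh_count \<alpha> m p" and ?N = "\<lambda>k. card {i \<in> {1..m}. p i \<le> \<alpha> * real k / real m}"
  assume "?N ?R \<noteq> ?R"
  then have "Suc ?R \<le> ?N ?R"
    using bh_count_le_card[of \<alpha> m p] by simp
  also have "?N ?R \<le> ?N (Suc ?R)"
  proof (intro card_mono)
    have "\<alpha> * real ?R / real m \<le> \<alpha> * real (Suc ?R) / real m"
      using assms by (intro divide_right_mono mult_left_mono) auto
    then show "{i \<in> {1..m}. p i \<le> \<alpha> * real ?R / real m} \<subseteq> {i \<in> {1..m}. p i \<le> \<alpha> * real (Suc ?R) / real m}"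
      by (intro Collect_mono) (meson order_trans)
  qed simp
  finally have le: "Suc ?R \<le> ?N (Suc ?R)" .
  also have "\<dots> \<le> m"
    using card_mono[of "{1..m}" "{i \<in> {1..m}. p i \<le> \<alpha> * real (Suc ?R) / real m}"]
    by (simp only: finite_atLeastAtMost Collect_restrict card_atLeastAtMost diff_Suc_1 simp_thms)
  finally have "Suc ?R \<le> ?R"
    using le by (intro le_bh_count)
  then show False by simp
qed

text \<open>The number \<open>N\<close> of p-values at most \<open>t\<close> meets the BH condition
  itself, because its threshold \<open>\<alpha> * N / m\<close> is at least \<open>t\<close>. A
  lower bound on the empirical distribution function at a single point thus bounds the number of
  rejections from below.\<close>

lemma card_le_bh_count:
  assumes "t \<le> \<alpha> * real (card {i \<in> {1..m}. p i \<le> t}) / real m"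
  shows "card {i \<in> {1..m}. p i \<le> t} \<le> bh_count \<alpha> m p"
proof (rule le_bh_count)
  let ?N = "card {i \<in> {1..m}. p i \<le> t}"
  show "?N \<le> m"
    using card_mono[of "{1..m}" "{i \<in> {1..m}. p i \<le> t}"]
    by (simp only: finite_atLeastAtMost Collect_restrict card_atLeastAtMost diff_Suc_1 simp_thms)
  show "?N \<le> card {i \<in> {1..m}. p i \<le> \<alpha> * real ?N / real m}"
    proof (intro card_mono)
    show "{i \<in> {1..m}. p i \<le> t} \<subseteq> {i \<in> {1..m}. p i \<le> \<alpha> * real ?N / real m}"
      using assms by (intro Collect_mono) (meson order_trans)
  qed simp
qed

lemma bh_set_nonempty:
  assumes "bh_count \<alpha> m p \<ge> 1"
  shows "bh_set \<alpha> m p \<noteq> {}"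
proof -
  have "bh_count \<alpha> m p \<le> card {i \<in> {1..m}. p i \<le> order_stat p {1..m} (bh_count \<alpha> m p)}"
    using assms bh_count_le[of \<alpha> m p] by (subst order_stat_le_iff[symmetric]) auto
  then have "{i \<in> {1..m}. p i \<le> order_stat p {1..m} (bh_count \<alpha> m p)} \<noteq> {}"
    using assms by (metis card.empty le_zero_eq not_one_le_zero)
  then show ?thesis
    using assms by (simp only: bh_set_def not_one_le_zero if_False split: if_splits) simp
qed

lemma simes_rejects_all_iff: "simes_rejects \<alpha> p {1..m} \<longleftrightarrow> bh_count \<alpha> m p \<ge> 1"
proof
  assume "simes_rejects \<alpha> p {1..m}"
  then obtain k where "k \<in> {1..m}" "k \<le> card {i \<in> {1..m}. p i \<le> \<alpha> * real k / real m}"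
    unfolding simes_rejects_def by (auto simp: order_stat_le_iff)
  then show "bh_count \<alpha> m p \<ge> 1"
    using le_bh_count[of k m p \<alpha>] by auto
next
  assume "bh_count \<alpha> m p \<ge> 1"
  then show "simes_rejects \<alpha> p {1..m}"
    using bh_count_props[of \<alpha> m p] unfolding simes_rejects_def
    by (intro bexI[of _ "bh_count \<alpha> m p"]) (auto simp: order_stat_le_iff)
qed

text \<open>For \<open>k\<close> at least the number of rejections, the \<open>k\<close>-th
  threshold is nonnegative and at least \<open>p i\<close>, so moving \<open>p i\<close> to 0 leaves
  the count below it unchanged. By \<open>bh_count_eq_iff\<close> these counts determine the
  value.\<close>

lemma bh_count_leave_one_out:
  assumes "0 \<le> \<alpha>" "p i \<le> \<alpha> * real (bh_count \<alpha> m p) / real m"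
  shows "bh_count \<alpha> m (p(i := 0)) = bh_count \<alpha> m p"
proof -
  let ?R = "bh_count \<alpha> m p" and ?q = "p(i := 0)"
  have eq: "{j \<in> {1..m}. ?q j \<le> \<alpha> * real k / real m} = {j \<in> {1..m}. p j \<le> \<alpha> * real k / real m}"
    if "?R \<le> k" for k
  proof -
    have "\<alpha> * real ?R / real m \<le> \<alpha> * real k / real m"
      using assms(1) that by (intro divide_right_mono mult_left_mono) auto
    then have "p i \<le> \<alpha> * real k / real m"
      using assms(2) by linarith
    moreover have "0 \<le> \<alpha> * real k / real m"
      using assms(1) by simp
    ultimately have "?q j \<le> \<alpha> * real k / real m \<longleftrightarrow> p j \<le> \<alpha> * real k / real m" for j
      by (cases "j = i") (simp_all only: fun_upd_same fun_upd_other not_False_eq_True)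
    then show ?thesis
      by (simp only:)
  qed
  have "?R \<le> card {j \<in> {1..m}. ?q j \<le> \<alpha> * real ?R / real m}"
    using bh_count_le_card[of \<alpha> m p] by (simp only: eq[OF order_refl])
  moreover have "\<forall>k \<in> {?R<..m}. \<not> k \<le> card {j \<in> {1..m}. ?q j \<le> \<alpha> * real k / real m}"
  proof
    fix k assume k: "k \<in> {?R<..m}"
    then have R: "?R < k" "k \<le> m" by simp_all
    show "\<not> k \<le> card {j \<in> {1..m}. ?q j \<le> \<alpha> * real k / real m}"
      unfolding eq[OF less_imp_le[OF R(1)]] using le_bh_count[OF R(2), of p \<alpha>] R(1) by linarith
  qed
  ultimately show ?thesis
    unfolding bh_count_eq_iff[of \<alpha> m ?q ?R] using bh_count_le[of \<alpha> m p] by (intro conjI)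
qed

section \<open>Measurability\<close>

lemma pred_le_card:
  fixes p :: "'a \<Rightarrow> nat \<Rightarrow> real"
  assumes "finite I" and [measurable]: "\<And>i. i \<in> I \<Longrightarrow> (\<lambda>\<omega>. p \<omega> i) \<in> borel_measurable M"
    "f \<in> borel_measurable M"
  shows "Measurable.pred M (\<lambda>\<omega>. k \<le> card {i \<in> I. p \<omega> i \<le> f \<omega>})"
proof -
  have "card {i \<in> I. p \<omega> i \<le> f \<omega>} = (\<Sum>i\<in>I. if p \<omega> i \<le> f \<omega> then 1 else 0)" for \<omega>
    using assms(1) by (simp add: sum.If_cases Int_def)
  then show ?thesis by simp
qed

lemma measurable_order_stat:
  fixes p :: "'a \<Rightarrow> nat \<Rightarrow> real"
  assumes "finite I" "\<And>i. i \<in> I \<Longrightarrow> (\<lambda>\<omega>. p \<omega> i) \<in> borel_measurable M" "k \<in> {1..card I}"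
  shows "(\<lambda>\<omega>. order_stat (p \<omega>) I k) \<in> borel_measurable M"
proof -
  have "order_stat (p \<omega>) I k \<le> t \<longleftrightarrow> k \<le> card {i \<in> I. p \<omega> i \<le> t}" for \<omega> t
    using assms(1,3) by (intro order_stat_le_iff) auto
  then have "{\<omega> \<in> space M. order_stat (p \<omega>) I k \<le> t} \<in> sets M" for t
    using pred_le_card[of I p M "\<lambda>_. t" k, OF assms(1,2)] by (simp only: pred_def borel_measurable_const)
  then show ?thesis
    unfolding borel_measurable_iff_le by (rule allI)
qed

lemma measurable_bh_count:
  fixes p :: "'a \<Rightarrow> nat \<Rightarrow> real"
  assumes "\<And>i. i \<in> {1..m} \<Longrightarrow> (\<lambda>\<omega>. p \<omega> i) \<in> borel_measurable M"
  shows "(\<lambda>\<omega>. bh_count \<alpha> m (p \<omega>)) \<in> measurable M (count_space UNIV)"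
proof -
  define Q where "Q k \<omega> \<longleftrightarrow> k \<le> card {i \<in> {1..m}. p \<omega> i \<le> \<alpha> * real k / real m}" for k \<omega>
  have [measurable]: "Measurable.pred M (Q k)" for k
    unfolding Q_def by (rule pred_le_card[OF finite_atLeastAtMost assms]) simp_all
  have "(\<lambda>\<omega>. bh_count \<alpha> m (p \<omega>)) -` {n} \<inter> space M \<in> sets M" for n
  proof -
    have "Measurable.pred M (\<lambda>\<omega>. bh_count \<alpha> m (p \<omega>) = n)"
      unfolding bh_count_eq_iff Q_def[symmetric] by measurable
    moreover have "(\<lambda>\<omega>. bh_count \<alpha> m (p \<omega>)) -` {n} \<inter> space M = {\<omega> \<in> space M. bh_count \<alpha> m (p \<omega>) = n}"
      by auto
    ultimately show ?thesis
      by (simp only: pred_def)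
  qed
  then show ?thesis
    by (subst measurable_count_space_eq2_countable) auto
qed

lemma pred_bh_set_eq:
  fixes p :: "'a \<Rightarrow> nat \<Rightarrow> real"
  assumes p [measurable]: "\<And>i. i \<in> {1..m} \<Longrightarrow> (\<lambda>\<omega>. p \<omega> i) \<in> borel_measurable M"
  shows "Measurable.pred M (\<lambda>\<omega>. bh_set \<alpha> m (p \<omega>) = S)"
proof -
  note [measurable] = measurable_bh_count[of m p M, OF p]
  have [measurable]: "(\<lambda>\<omega>. order_stat (p \<omega>) {1..m} k) \<in> borel_measurable M" if "k \<in> {1..m}" for k
    using that by (intro measurable_order_stat p) auto
  \<comment> \<open>The order statistic in \<open>bh_set\<close> has a random index. Splitting over
    the finitely many values of \<open>bh_count\<close> leaves order statistics of fixed index,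
    which are measurable.\<close>
  have "bh_set \<alpha> m (p \<omega>) = S \<longleftrightarrow> (bh_count \<alpha> m (p \<omega>) = 0 \<and> S = {}) \<or>
      (\<exists>k \<in> {1..m}. bh_count \<alpha> m (p \<omega>) = k \<and> S \<subseteq> {1..m} \<and>
        (\<forall>i \<in> {1..m}. i \<in> S \<longleftrightarrow> p \<omega> i \<le> order_stat (p \<omega>) {1..m} k))" for \<omega>
  proof (cases "bh_count \<alpha> m (p \<omega>) = 0")
    case True
    then show ?thesis by (auto simp: bh_set_def)
  next
    case False
    let ?k = "bh_count \<alpha> m (p \<omega>)"
    have "bh_set \<alpha> m (p \<omega>) = {i \<in> {1..m}. p \<omega> i \<le> order_stat (p \<omega>) {1..m} ?k}"
      using False by (simp only: bh_set_def if_False)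
    moreover have "?k \<in> {1..m}"
      using False bh_count_le[of \<alpha> m "p \<omega>"] by simp
    ultimately show ?thesis
      using False by blast
  qed
  then show ?thesis by (simp only:) measurable
qed

lemma pred_simes_rejects:
  fixes p :: "'a \<Rightarrow> nat \<Rightarrow> real"
  assumes "finite J" "\<And>i. i \<in> J \<Longrightarrow> (\<lambda>\<omega>. p \<omega> i) \<in> borel_measurable M"
  shows "Measurable.pred M (\<lambda>\<omega>. simes_rejects \<delta> (p \<omega>) J)"
proof -
  note [measurable] = measurable_order_stat[of J p M, OF assms]
  show ?thesis
    unfolding simes_rejects_def by measurable
qed

lemma pred_closed_rejects:
  fixes p :: "'a \<Rightarrow> nat \<Rightarrow> real"
  assumes p: "\<And>i. i \<in> {1..m} \<Longrightarrow> (\<lambda>\<omega>. p \<omega> i) \<in> borel_measurable M"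
  shows "Measurable.pred M (\<lambda>\<omega>. closed_rejects \<delta> m (p \<omega>) I)"
proof -
  let ?\<J> = "{J. I \<subseteq> J \<and> J \<subseteq> {1..m}}"
  have [measurable]: "Measurable.pred M (\<lambda>\<omega>. simes_rejects \<delta> (p \<omega>) J)" if "J \<in> ?\<J>" for J
    using that finite_subset[of J "{1..m}"] by (intro pred_simes_rejects p) auto
  have [measurable]: "countable ?\<J>"
    by (rule countable_finite, rule finite_subset[of _ "Pow {1..m}"]) auto
  \<comment> \<open>With the supersets collected in a finite family, the universal quantifier
    becomes a countable intersection of events.\<close>
  have "closed_rejects \<delta> m (p \<omega>) I \<longleftrightarrow> I \<noteq> {} \<and> (\<forall>J \<in> ?\<J>. simes_rejects \<delta> (p \<omega>) J)" for \<omega>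
    by (auto simp: closed_rejects_def)
  then show ?thesis by (simp only:) measurable
qed

section \<open>Simes' inequality\<close>

text \<open>Isolates what the sampling arguments use about the law of one coordinate. The mixture
  structure enters them only through bounds on the distribution function of the p-value.\<close>

locale pvalue_sample =
  fixes C :: "(bool \<times> real) measure"
  assumes prob_space_C: "prob_space C"
    and measurable_snd_C [measurable]: "snd \<in> borel_measurable C"
begin

abbreviation sample :: "nat \<Rightarrow> (nat \<Rightarrow> bool \<times> real) measure" where
  "sample m \<equiv> PiM {1..m} (\<lambda>_. C)"

lemma prob_space_sample: "prob_space (sample m)"
  by (rule prob_space_PiM) (rule prob_space_C)

lemma measurable_pvals [measurable]:
  "i \<in> {1..m} \<Longrightarrow> (\<lambda>\<omega>. pvals \<omega> i) \<in> borel_measurable (sample m)"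
  unfolding pvals_def by measurable

text \<open>When BH makes \<open>R \<ge> 1\<close> rejections, exactly \<open>R\<close> p-values lie
  below its threshold, so weights \<open>1 / R\<close> on them sum to 1. Given the other p-values,
  the leave-one-out count \<open>r\<close> is fixed, and the expected weight of \<open>i\<close> is
  at most \<open>a * (\<delta> * r / m) / r = a * \<delta> / m\<close>. Summing over
  \<open>i\<close> gives the claim.\<close>

lemma prob_simes_rejects_all_le:
  assumes "0 \<le> \<delta>" "\<delta> \<le> 1" "0 \<le> a"
    and F: "\<And>t. t \<in> {0..1} \<Longrightarrow> measure C {x \<in> space C. snd x \<le> t} \<le> a * t"
  shows "measure (sample m) {\<omega> \<in> space (sample m). simes_rejects \<delta> (pvals \<omega>) {1..m}} \<le> a * \<delta>"
proof -
  interpret C: prob_space C by (rule prob_space_C)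
  interpret product_prob_space "\<lambda>_::nat. C" UNIV
    by (intro product_prob_spaceI prob_space_C)
  interpret sample: prob_space "sample m" by (rule prob_space_sample)
  define R where "R i \<omega> = bh_count \<delta> m ((pvals \<omega>)(i := 0))" for i \<omega>
  \<comment> \<open>The weight is written with the leave-one-out count, so that only the comparison
    with the threshold involves coordinate \<open>i\<close>.\<close>
  define f where "f i \<omega> = (if pvals \<omega> i \<le> \<delta> * real (R i \<omega>) / real m
    then ennreal (1 / real (R i \<omega>)) else 0)" for i \<omega>
  have [measurable]: "R i \<in> measurable (sample m) (count_space UNIV)" for i
    unfolding R_def
  proof (intro measurable_bh_count)
    fix j assume "j \<in> {1..m}"
    then show "(\<lambda>\<omega>. ((pvals \<omega>)(i := 0)) j) \<in> borel_measurable (sample m)"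
      using measurable_pvals[of j m] by (cases "j = i") simp_all
  qed
  have f_measurable [measurable]: "f i \<in> borel_measurable (sample m)" if [measurable]: "i \<in> {1..m}" for i
    unfolding f_def by measurable
  let ?A = "{\<omega> \<in> space (sample m). simes_rejects \<delta> (pvals \<omega>) {1..m}}"
  have A: "?A \<in> sets (sample m)"
    using pred_simes_rejects[OF finite_atLeastAtMost measurable_pvals] by (simp only: pred_def)
  have cover: "indicator ?A \<omega> \<le> (\<Sum>i\<in>{1..m}. f i \<omega>)" for \<omega>
  proof (cases "\<omega> \<in> ?A")
    case True
    let ?r = "bh_count \<delta> m (pvals \<omega>)"
    let ?S = "{i \<in> {1..m}. pvals \<omega> i \<le> \<delta> * real ?r / real m}"
    have r: "?r \<ge> 1" using True simes_rejects_all_iff[of \<delta> "pvals \<omega>" m] by blast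
    have "f i \<omega> = ennreal (1 / real ?r)" if "i \<in> ?S" for i
      using that bh_count_leave_one_out[OF assms(1), of "pvals \<omega>" i m] by (simp add: f_def R_def)
    then have "(\<Sum>i\<in>?S. f i \<omega>) = of_nat (card ?S) * ennreal (1 / real ?r)"
      by simp
    also have "\<dots> = ennreal (real ?r) * ennreal (1 / real ?r)"
      using card_bh_threshold[OF assms(1), of m "pvals \<omega>"] by (simp add: ennreal_of_nat_eq_real_of_nat)
    also have "\<dots> = 1"
      using r by (simp flip: ennreal_mult)
    finally have "1 \<le> (\<Sum>i\<in>?S. f i \<omega>)" by simp
    also have "\<dots> \<le> (\<Sum>i\<in>{1..m}. f i \<omega>)"
      by (intro sum_mono2) auto
    finally show ?thesis using True by simp
  qed simp
  have int_f: "(\<integral>\<^sup>+ \<omega>. f i \<omega> \<partial>sample m) \<le> ennreal (a * \<delta> / real m)" if i: "i \<in> {1..m}" for i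
  proof -
    let ?I = "{1..m} - {i}"
    interpret I: prob_space "PiM ?I (\<lambda>_. C)" by (rule prob_space_PiM) (rule prob_space_C)
    have ins: "insert i ?I = {1..m}" using i by auto
    have inner: "(\<integral>\<^sup>+ y. f i (x(i := y)) \<partial>C) \<le> ennreal (a * \<delta> / real m)" for x
    proof -
      define r where "r = bh_count \<delta> m ((pvals x)(i := 0))"
      define c where "c = \<delta> * real r / real m"
      have r: "r \<le> m" unfolding r_def by (rule bh_count_le)
      \<comment> \<open>The assumption on the distribution function covers \<open>{0..1}\<close>
        only; \<open>r \<le> m\<close> and \<open>\<delta> \<le> 1\<close> keep the threshold
        there.\<close>
      have c: "c \<in> {0..1}"
        using r assms(1,2) i mult_mono[of \<delta> 1 "real r" "real m"]
        by (auto simp: c_def divide_le_eq)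
      have "pvals (x(i := y)) = (pvals x)(i := snd y)" for y
        by (auto simp: pvals_def)
      then have "(\<integral>\<^sup>+ y. f i (x(i := y)) \<partial>C) =
          (\<integral>\<^sup>+ y. ennreal (1 / real r) * indicator {y \<in> space C. snd y \<le> c} y \<partial>C)"
        by (intro nn_integral_cong) (auto simp: f_def R_def r_def c_def)
      also have "\<dots> = ennreal (1 / real r) * ennreal (measure C {y \<in> space C. snd y \<le> c})"
        by (subst nn_integral_cmult_indicator) (simp_all add: C.emeasure_eq_measure)
      also have "\<dots> \<le> ennreal (1 / real r) * ennreal (a * c)"
        using F[OF c] by (intro mult_left_mono ennreal_leI) auto
      also have "\<dots> = ennreal (1 / real r * (a * c))"
        using assms c by (subst ennreal_mult) auto
      \<comment> \<open>The factor \<open>r\<close> in \<open>c\<close> cancels; for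
        \<open>r = 0\<close> the left side is 0.\<close>
      also have "\<dots> \<le> ennreal (a * \<delta> / real m)"
        using assms by (intro ennreal_leI) (auto simp: c_def)
      finally show ?thesis .
    qed
    \<comment> \<open>Fubini: coordinate \<open>i\<close> is integrated first, with all others
      fixed.\<close>
    have "(\<integral>\<^sup>+ \<omega>. f i \<omega> \<partial>sample m) = (\<integral>\<^sup>+ x. (\<integral>\<^sup>+ y. f i (x(i := y)) \<partial>C) \<partial>PiM ?I (\<lambda>_. C))"
      by (rule product_nn_integral_insert[of ?I i "f i", unfolded ins, OF _ _ f_measurable[OF i]]) simp_all
    also have "\<dots> \<le> (\<integral>\<^sup>+ x. ennreal (a * \<delta> / real m) \<partial>PiM ?I (\<lambda>_. C))"
      by (intro nn_integral_mono inner)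
    also have "\<dots> = ennreal (a * \<delta> / real m)"
      by (simp only: nn_integral_const I.emeasure_space_1 mult_1_right)
    finally show ?thesis .
  qed
  have "emeasure (sample m) ?A = (\<integral>\<^sup>+ \<omega>. indicator ?A \<omega> \<partial>sample m)"
    using A by simp
  also have "\<dots> \<le> (\<integral>\<^sup>+ \<omega>. (\<Sum>i\<in>{1..m}. f i \<omega>) \<partial>sample m)"
    by (intro nn_integral_mono cover)
  also have "\<dots> = (\<Sum>i\<in>{1..m}. \<integral>\<^sup>+ \<omega>. f i \<omega> \<partial>sample m)"
    by (intro nn_integral_sum) measurable
  also have "\<dots> \<le> (\<Sum>i\<in>{1..m}. ennreal (a * \<delta> / real m))"
    by (intro sum_mono int_f)
  also have "\<dots> = ennreal (\<Sum>i\<in>{1..m}. a * \<delta> / real m)"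
    using assms by (intro sum_ennreal) auto
  also have "\<dots> \<le> ennreal (a * \<delta>)"
    using assms by (intro ennreal_leI) auto
  finally show ?thesis
    using assms(1,3) by (simp only: sample.emeasure_eq_measure ennreal_le_iff mult_nonneg_nonneg)
qed

section \<open>Number of rejections\<close>

text \<open>Independence is equality of the joint law with the product of the marginals. Points of
  the product space are extensional, so restriction to \<open>{1..m}\<close> is the identity
  there.\<close>

lemma indep_vars_components:
  assumes "m \<ge> 1"
  shows "prob_space.indep_vars (sample m) (\<lambda>_. C) (\<lambda>i \<omega>. \<omega> i) {1..m}"
proof -
  have "distr (sample m) (sample m) (\<lambda>x. \<lambda>i\<in>{1..m}. x i) = distr (sample m) (sample m) (\<lambda>x. x)"
    by (intro distr_cong) (auto simp: space_PiM PiE_def extensional_restrict)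
  also have "\<dots> = sample m"
    by (rule distr_id)
  also have "\<dots> = PiM {1..m} (\<lambda>i. distr (sample m) C (\<lambda>x. x i))"
    by (intro PiM_cong refl distr_PiM_component[symmetric] prob_space_C)
  finally show ?thesis
    using assms by (subst prob_space.indep_vars_iff_distr_eq_PiM'[OF prob_space_sample]) auto
qed

text \<open>Hoeffding's inequality for the independent indicators of
  \<open>pvals \<omega> i \<le> t\<close>, each of mean \<open>q\<close>, with deviation
  \<open>m * \<eta>\<close>.\<close>

lemma prob_card_pvals_le:
  fixes t \<eta> :: real
  assumes "0 \<le> \<eta>" "m \<ge> 1"
  defines "q \<equiv> measure C {x \<in> space C. snd x \<le> t}"
  shows "measure (sample m) {\<omega> \<in> space (sample m).
      real (card {i \<in> {1..m}. pvals \<omega> i \<le> t}) \<le> real m * (q - \<eta>)} \<le> exp (- 2 * \<eta>\<^sup>2 * real m)"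
proof -
  let ?X = "\<lambda>i \<omega>. indicator {..t} (pvals \<omega> i) :: real"
  interpret C: prob_space C by (rule prob_space_C)
  interpret sample: prob_space "sample m" by (rule prob_space_sample)
  have exp_X: "sample.expectation (?X i) = q" if i: "i \<in> {1..m}" for i
  proof -
    have "sample.expectation (?X i) = (\<integral>x. indicator {..t} (snd x) \<partial>distr (sample m) C (\<lambda>\<omega>. \<omega> i))"
      using i by (subst integral_distr) (auto simp: pvals_def)
    also have "\<dots> = (\<integral>x. indicator {..t} (snd x) \<partial>C)"
      using distr_PiM_component[of "{1..m}" "\<lambda>_. C" i] prob_space_C i by simp
    also have "\<dots> = (\<integral>x. indicator {x \<in> space C. snd x \<le> t} x \<partial>C)"
      by (intro Bochner_Integration.integral_cong) (auto simp: indicator_def)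
    also have "\<dots> = q"
      by (simp add: q_def)
    finally show ?thesis .
  qed
  interpret H: Hoeffding_ineq "sample m" "{1..m}" ?X "\<lambda>_. 0" "\<lambda>_. 1" "real m * q"
  proof unfold_locales
    show "sample.indep_vars (\<lambda>_. borel) ?X {1..m}"
      unfolding pvals_def by (rule sample.indep_vars_compose2[OF indep_vars_components[OF assms(2)]]) measurable
    have "(\<Sum>i\<in>{1..m}. sample.expectation (?X i)) = real m * q"
      using exp_X by simp
    then show "real m * q \<equiv> (\<Sum>i\<in>{1..m}. sample.expectation (?X i))"
      by simp
  qed (auto simp: indicator_def)
  have card: "real (card {i \<in> {1..m}. pvals \<omega> i \<le> t}) = (\<Sum>i\<in>{1..m}. ?X i \<omega>)" for \<omega>
    by (simp add: indicator_def sum.If_cases Int_def)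
  have "measure (sample m) {\<omega> \<in> space (sample m). (\<Sum>i\<in>{1..m}. ?X i \<omega>) \<le> real m * q - real m * \<eta>}
      \<le> exp (- 2 * (real m * \<eta>)\<^sup>2 / (\<Sum>i\<in>{1..m}. (1 - 0)\<^sup>2))"
    using assms(1,2) by (intro H.Hoeffding_ineq_le) auto
  also have "- 2 * (real m * \<eta>)\<^sup>2 / (\<Sum>i\<in>{1..m}. (1 - 0)\<^sup>2) = - 2 * \<eta>\<^sup>2 * real m"
    using assms(2) by (simp add: power2_eq_square)
  finally show ?thesis
    by (simp only: card right_diff_distrib)
qed

lemma prob_bh_count_le_tendsto_0:
  assumes "0 < \<alpha>" "t / \<alpha> < measure C {x \<in> space C. snd x \<le> t}"
  shows "(\<lambda>m. measure (sample m)
      {\<omega> \<in> space (sample m). real (bh_count \<alpha> m (pvals \<omega>)) \<le> real m * (t / \<alpha>)}) \<longlonglongrightarrow> 0"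
proof -
  define q where "q = measure C {x \<in> space C. snd x \<le> t}"
  \<comment> \<open>With this gap, \<open>m * (q - \<eta>)\<close> is the target
    \<open>m * (t / \<alpha>)\<close>. More than that many p-values at most \<open>t\<close> would
    force as many BH rejections.\<close>
  define \<eta> where "\<eta> = q - t / \<alpha>"
  have \<eta>: "\<eta> > 0" using assms by (simp add: \<eta>_def q_def)
  have le: "measure (sample m) {\<omega> \<in> space (sample m). real (bh_count \<alpha> m (pvals \<omega>)) \<le> real m * (t / \<alpha>)}
      \<le> exp (- 2 * \<eta>\<^sup>2 * real m)" if m: "m \<ge> 1" for m
  proof -
    interpret sample: prob_space "sample m" by (rule prob_space_sample)
    define N where "N \<omega> = card {i \<in> {1..m}. pvals \<omega> i \<le> t}" for \<omega>
    have sub: "real (N \<omega>) \<le> real m * (q - \<eta>)"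
      if le: "real (bh_count \<alpha> m (pvals \<omega>)) \<le> real m * (t / \<alpha>)" for \<omega>
    proof (rule ccontr)
      assume "\<not> ?thesis"
      then have gt: "real m * (t / \<alpha>) < real (N \<omega>)"
        by (simp add: \<eta>_def)
      then have "t \<le> \<alpha> * real (N \<omega>) / real m"
        using m assms(1) by (simp add: field_simps)
      then have "N \<omega> \<le> bh_count \<alpha> m (pvals \<omega>)"
        unfolding N_def by (rule card_le_bh_count)
      then show False
        using gt le by linarith
    qed
    have "{\<omega> \<in> space (sample m). real (N \<omega>) \<le> real m * (q - \<eta>)} \<in> sets (sample m)"
    proof -
      have "real (N \<omega>) \<le> real m * (q - \<eta>) \<longleftrightarrow> (\<forall>k. k \<le> N \<omega> \<longrightarrow> real k \<le> real m * (q - \<eta>))" for \<omega>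
        by (meson of_nat_le_iff order_refl order_trans)
      moreover have [measurable]: "Measurable.pred (sample m) (\<lambda>\<omega>. k \<le> N \<omega>)" for k
        unfolding N_def by (rule pred_le_card[OF finite_atLeastAtMost measurable_pvals]) simp_all
      ultimately show ?thesis
        by (simp only:) measurable
    qed
    then have "measure (sample m) {\<omega> \<in> space (sample m). real (bh_count \<alpha> m (pvals \<omega>)) \<le> real m * (t / \<alpha>)}
      \<le> measure (sample m) {\<omega> \<in> space (sample m). real (N \<omega>) \<le> real m * (q - \<eta>)}"
      using sub by (intro sample.finite_measure_mono) blast+
    also have "\<dots> \<le> exp (- 2 * \<eta>\<^sup>2 * real m)"
      unfolding q_def N_def using \<eta> m by (intro prob_card_pvals_le) auto
    finally show ?thesis .
  qed
  have lim: "(\<lambda>m. exp (- 2 * \<eta>\<^sup>2 * real m)) \<longlonglongrightarrow> 0"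
    using \<eta> by real_asymp
  show ?thesis
  proof (rule tendsto_sandwich[OF _ _ tendsto_const lim])
    show "\<forall>\<^sub>F m in sequentially. measure (sample m)
        {\<omega> \<in> space (sample m). real (bh_count \<alpha> m (pvals \<omega>)) \<le> real m * (t / \<alpha>)} \<le> exp (- 2 * \<eta>\<^sup>2 * real m)"
      using le by (rule eventually_sequentiallyI)
  qed (simp add: measure_nonneg)
qed

section \<open>Consistency\<close>

text \<open>Reduces consistency to a deterministic estimate, valid for large \<open>m\<close>
  whenever BH rejects more than \<open>m * c\<close> hypotheses.\<close>

lemma tendsto_prob_bound_excess:
  assumes c: "(\<lambda>m. measure (sample m)
      {\<omega> \<in> space (sample m). real (bh_count \<alpha> m (pvals \<omega>)) \<le> real m * c}) \<longlonglongrightarrow> 0"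
    and B: "\<forall>\<^sub>F m in sequentially. \<forall>p. real m * c < real (bh_count \<alpha> m p) \<longrightarrow> B m p - \<alpha> < \<epsilon>"
  shows "(\<lambda>m. measure (sample m) {\<omega> \<in> space (sample m). B m (pvals \<omega>) - \<alpha> \<ge> \<epsilon>}) \<longlonglongrightarrow> 0"
proof (rule tendsto_sandwich[OF _ _ tendsto_const c])
  show "\<forall>\<^sub>F m in sequentially. measure (sample m) {\<omega> \<in> space (sample m). B m (pvals \<omega>) - \<alpha> \<ge> \<epsilon>}
      \<le> measure (sample m) {\<omega> \<in> space (sample m). real (bh_count \<alpha> m (pvals \<omega>)) \<le> real m * c}"
    using B
  proof eventually_elim
    case (elim m)
    interpret sample: prob_space "sample m" by (rule prob_space_sample)
    have "Measurable.pred (sample m) (\<lambda>\<omega>. real (bh_count \<alpha> m (pvals \<omega>)) \<le> real m * c)"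
      by (rule measurable_compose[OF measurable_bh_count[OF measurable_pvals]]) (simp_all only: measurable_count_space)
    then have meas: "{\<omega> \<in> space (sample m). real (bh_count \<alpha> m (pvals \<omega>)) \<le> real m * c} \<in> sets (sample m)"
      by (simp only: pred_def)
    show ?case
    \<comment> \<open>Monotonicity asks for measurability of the larger event only, so
      \<open>B\<close> may be an arbitrary function of the p-values.\<close>
    proof (rule sample.finite_measure_mono)
      show "{\<omega> \<in> space (sample m). B m (pvals \<omega>) - \<alpha> \<ge> \<epsilon>}
          \<subseteq> {\<omega> \<in> space (sample m). real (bh_count \<alpha> m (pvals \<omega>)) \<le> real m * c}"
        using elim by (intro Collect_mono) (meson not_less)
    qed (rule meas)
  qed
qed (simp add: measure_nonneg)

end

section \<open>Deterministic estimates for \<open>dkw_fdp_bound\<close> and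
  \<open>well_fdp_bound\<close>\<close>

lemma dkw_fdp_bound_eventually_less:
  assumes "0 < \<delta>" "\<delta> \<le> 1" "0 < c" "0 < \<epsilon>"
  shows "\<forall>\<^sub>F m in sequentially. \<forall>p. real m * c < real (bh_count \<alpha> m p) \<longrightarrow> dkw_fdp_bound \<alpha> \<delta> m p - \<alpha> < \<epsilon>"
proof -
  define K where "K = sqrt (0.5 * ln (1 / \<delta>))"
  have K: "K \<ge> 0" using assms by (simp add: K_def)
  have "(\<lambda>m. sqrt (real m) * K / (real m * c)) \<longlonglongrightarrow> 0"
  proof -
    have "(\<lambda>m. sqrt (real m) / real m) \<longlonglongrightarrow> 0"
      by real_asymp
    from tendsto_mult_right_zero[OF this, of "K / c"] show ?thesis
      by (simp add: mult_ac)
  qed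
  then have "\<forall>\<^sub>F m in sequentially. sqrt (real m) * K / (real m * c) < \<epsilon>"
    using assms(4) by (rule order_tendstoD)
  then show ?thesis
    using eventually_ge_at_top[of 1]
  proof eventually_elim
    case (elim m)
    show ?case
    proof (intro allI impI)
      fix p assume k: "real m * c < real (bh_count \<alpha> m p)"
      let ?k = "bh_count \<alpha> m p"
      have "dkw_fdp_bound \<alpha> \<delta> m p \<le> \<alpha> + sqrt (real m) * K / real (max 1 ?k)"
        unfolding dkw_fdp_bound_def Let_def K_def by (rule min.cobounded2)
      also have "sqrt (real m) * K / real (max 1 ?k) \<le> sqrt (real m) * K / (real m * c)"
        using k K assms(3) elim(2) by (intro divide_left_mono mult_pos_pos mult_nonneg_nonneg) auto
      finally show "dkw_fdp_bound \<alpha> \<delta> m p - \<alpha> < \<epsilon>"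
        using elim(1) by linarith
    qed
  qed
qed

text \<open>The derivative of \<open>h_fun\<close> is \<open>ln\<close>, positive beyond 1. The
  endpoint 1 is included so that the value \<open>h_fun 1 = 0\<close> can serve for
  comparison.\<close>

lemma h_fun_strict_mono_on: "strict_mono_on {1..} h_fun"
proof (rule strict_mono_onI)
  fix x y :: real assume xy: "x \<in> {1..}" "y \<in> {1..}" "x < y"
  have "\<exists>z. x < z \<and> z < y \<and> h_fun y - h_fun x = (y - x) * ln z"
  proof (rule MVT2[OF xy(3)])
    fix z assume "x \<le> z" "z \<le> y"
    then show "DERIV h_fun z :> ln z"
      unfolding h_fun_def using xy by (auto intro!: derivative_eq_intros)
  qed
  then obtain z where "x < z" "h_fun y - h_fun x = (y - x) * ln z"
    by blast
  moreover from this have "(y - x) * ln z > 0"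
    using xy by (intro mult_pos_pos) auto
  ultimately show "h_fun x < h_fun y" by linarith
qed

text \<open>Since \<open>h_inv\<close> is an \<open>inv_into\<close>, \<open>y\<close> must first be
  shown to be a value of \<open>h_fun\<close> on \<open>{1<..}\<close>. The intermediate value
  theorem on \<open>{1..u}\<close> gives a preimage; it differs from 1 because \<open>y > 0\<close>
  and from \<open>u\<close> because \<open>y < h_fun u\<close>.\<close>

lemma h_inv_less:
  assumes "1 < u" "0 < y" "y < h_fun u"
  shows "h_inv y < u"
proof -
  have "continuous_on {1..u} h_fun"
    unfolding h_fun_def by (intro continuous_intros) auto
  then obtain x where x: "1 \<le> x" "x \<le> u" "h_fun x = y"
    using IVT'[of h_fun 1 y u] assms by (auto simp: h_fun_def)
  have "x \<noteq> 1" using x assms by (auto simp: h_fun_def)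
  moreover have "inj_on h_fun {1<..}"
    using strict_mono_on_imp_inj_on[OF h_fun_strict_mono_on] by (rule inj_on_subset) auto
  ultimately have "h_inv y = x"
    using x inv_into_f_f[of h_fun "{1<..}" x] by (simp add: h_inv_def)
  then show ?thesis
    using x assms by (cases "x = u") auto
qed

text \<open>The first two terms \<open>1 + 1 / 4\<close> of the series of inverse squares suffice.
  This makes \<open>ln (\<kappa> / \<delta>)\<close> positive for
  \<open>\<delta> \<le> 1\<close>.\<close>

lemma pi_squared_gt_6: "pi\<^sup>2 / 6 > (1::real)"
proof -
  have "(\<Sum>n<2. 1 / (1 + real n)\<^sup>2) \<le> pi\<^sup>2 / 6"
    using sum_le_suminf[OF sums_summable[OF inverse_squares_sums], of "{..<2}"]
      sums_unique[OF inverse_squares_sums] by simp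
  then show ?thesis
    by (simp add: numeral_2_eq_2)
qed

lemma well_fdp_bound_eventually_less:
  assumes "0 < \<delta>" "\<delta> \<le> 1" "0 < \<alpha>" "\<alpha> \<le> 1" "0 < c" "0 < \<epsilon>"
  shows "\<forall>\<^sub>F m in sequentially. \<forall>p. real m * c < real (bh_count \<alpha> m p) \<longrightarrow> well_fdp_bound \<alpha> \<delta> m p - \<alpha> < \<epsilon>"
proof -
  define A where "A = 2 * ln (pi\<^sup>2 / 6 / \<delta>)"
  \<comment> \<open>The numerator in the argument of \<open>h_inv\<close> with \<open>k\<close>
    replaced by its lower bound \<open>m * c\<close>; it no longer depends on
    \<open>m\<close>.\<close>
  define D where "D = A + 4 * ln (1 + log 2 (1 / (\<alpha> * c)))"
  have A: "A > 0"
  proof -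
    have "pi\<^sup>2 / 6 / \<delta> > 1"
      using pi_squared_gt_6 assms(1,2) by (simp only: less_divide_eq_1_pos)
    then show ?thesis by (simp add: A_def)
  qed
  \<comment> \<open>The point \<open>1 + \<epsilon> / \<alpha>\<close> is where
    \<open>\<alpha>\<close> times the value of \<open>h_inv\<close> would reach
    \<open>\<alpha> + \<epsilon>\<close>.\<close>
  have h: "h_fun (1 + \<epsilon> / \<alpha>) > 0"
  proof -
    have "h_fun 1 < h_fun (1 + \<epsilon> / \<alpha>)"
      using assms by (intro strict_mono_onD[OF h_fun_strict_mono_on]) auto
    moreover have "h_fun 1 = 0"
      by (simp add: h_fun_def)
    ultimately show ?thesis by simp
  qed
  have "(\<lambda>m. D / (\<alpha> * (real m * c))) \<longlonglongrightarrow> 0"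
  proof -
    have "D / (\<alpha> * (real m * c)) = D / (\<alpha> * c) * (1 / real m)" for m
      by simp
    then show ?thesis
      using tendsto_mult_right_zero[OF lim_1_over_n, of "D / (\<alpha> * c)"] by (simp only:)
  qed
  then have "\<forall>\<^sub>F m in sequentially. D / (\<alpha> * (real m * c)) < h_fun (1 + \<epsilon> / \<alpha>)"
    using h by (rule order_tendstoD)
  then show ?thesis
    using eventually_ge_at_top[of 1]
  proof eventually_elim
    case (elim m)
    show ?case
    proof (intro allI impI)
      fix p assume bh: "real m * c < real (bh_count \<alpha> m p)"
      define k where "k = bh_count \<alpha> m p"
      have k: "real m * c < real k" using bh by (simp only: k_def)
      define L where "L = log 2 (real m / (\<alpha> * real k))"
      define X where "X = (A + 4 * ln (1 + L)) / (\<alpha> * real k)"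
      have mc: "0 < real m * c" using elim(2) assms(5) by simp
      then have kpos: "0 < real k" using k by linarith
      then have max: "max 1 k = k" by simp
      have km: "real k \<le> real m" unfolding k_def of_nat_le_iff by (rule bh_count_le)
      have \<alpha>k: "0 < \<alpha> * real k" using assms kpos by simp
      \<comment> \<open>Makes the base-2 logarithm nonnegative, so that the argument
        \<open>X\<close> of \<open>h_inv\<close> is positive and \<open>h_inv_less\<close>
        applies.\<close>
      have "\<alpha> * real k \<le> real m"
        using km assms mult_mono[of \<alpha> 1 "real k" "real m"] by simp
      then have L0: "0 \<le> L"
        unfolding L_def using \<alpha>k by (simp add: zero_le_log_cancel_iff le_divide_eq)
      have den: "0 < \<alpha> * (real m * c)" "\<alpha> * (real m * c) \<le> \<alpha> * real k"
        using mult_pos_pos[OF assms(3) mc] mult_left_mono[OF less_imp_le[OF k], of \<alpha>] assms(3) by simp_all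
      have "real m / (\<alpha> * real k) \<le> real m / (\<alpha> * (real m * c))"
        by (rule divide_left_mono[OF den(2) _ mult_pos_pos[OF \<alpha>k den(1)]]) simp
      also have "\<dots> = 1 / (\<alpha> * c)"
        using elim(2) by simp
      finally have L1: "L \<le> log 2 (1 / (\<alpha> * c))"
        unfolding L_def using \<alpha>k elim(2) assms by (subst log_le_cancel_iff) auto
      have num: "0 \<le> ln (1 + L)" "ln (1 + L) \<le> ln (1 + log 2 (1 / (\<alpha> * c)))"
        using L0 L1 by auto
      have "0 < X"
        unfolding X_def using A num(1) \<alpha>k by (intro divide_pos_pos) auto
      moreover have "X \<le> D / (\<alpha> * (real m * c))"
        unfolding X_def D_def using A num den by (intro frac_le) auto
      ultimately have "h_inv X < 1 + \<epsilon> / \<alpha>"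
        using elim(1) assms by (intro h_inv_less) auto
      then have "\<alpha> * h_inv X < \<alpha> * (1 + \<epsilon> / \<alpha>)"
        using assms by (intro mult_strict_left_mono)
      also have "\<dots> = \<alpha> + \<epsilon>"
        using assms by (simp add: field_simps)
      finally have "\<alpha> * h_inv X < \<alpha> + \<epsilon>" .
      moreover have "well_fdp_bound \<alpha> \<delta> m p \<le> \<alpha> * h_inv X"
        unfolding well_fdp_bound_def Let_def k_def[symmetric] X_def L_def A_def max by (rule min.cobounded2)
      ultimately show "well_fdp_bound \<alpha> \<delta> m p - \<alpha> < \<epsilon>"
        by linarith
    qed
  qed
qed

section \<open>Inconsistency of the Simes-based closed testing bound\<close>

lemma simes_fdp_bound_ge_1_iff:
  "simes_fdp_bound \<alpha> \<delta> m p \<ge> 1 \<longleftrightarrow>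
     bh_set \<alpha> m p \<noteq> {} \<and> \<not> closed_rejects \<delta> m p (bh_set \<alpha> m p)"
proof -
  define R where "R = bh_set \<alpha> m p"
  define S where "S = {card I |I. I \<subseteq> R \<and> \<not> closed_rejects \<delta> m p I}"
  have R: "finite R" unfolding R_def bh_set_def by simp
  have "S = card ` {I. I \<subseteq> R \<and> \<not> closed_rejects \<delta> m p I}"
    unfolding S_def by blast
  moreover have "finite {I. I \<subseteq> R \<and> \<not> closed_rejects \<delta> m p I}"
    using R by (rule finite_subset[rotated, OF finite_Pow_iff[THEN iffD2]]) blast
  ultimately have S: "finite S"
    by simp
  \<comment> \<open>The empty set is never rejected, so the maximum is over a nonempty set and is
    attained.\<close>
  have "card ({} :: nat set) \<in> S"
    unfolding S_def closed_rejects_def by blast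
  then have "Max S \<in> S"
    using S by (intro Max_in) auto
  then obtain I where I: "I \<subseteq> R" "\<not> closed_rejects \<delta> m p I" "Max S = card I"
    unfolding S_def by blast
  have "simes_fdp_bound \<alpha> \<delta> m p = real (Max S) / real (max (card R) 1)"
    unfolding simes_fdp_bound_def simes_fp_bound_def R_def S_def ..
  then have "simes_fdp_bound \<alpha> \<delta> m p \<ge> 1 \<longleftrightarrow> real (max (card R) 1) \<le> real (Max S)"
    by (simp add: le_divide_eq)
  \<comment> \<open>A subset of \<open>R\<close> with at least \<open>card R\<close> elements is
    \<open>R\<close> itself. The condition \<open>1 \<le> Max S\<close> excludes the empty
    \<open>R\<close>.\<close>
  also have "\<dots> \<longleftrightarrow> card R \<le> Max S \<and> 1 \<le> Max S"
    by (simp only: of_nat_le_iff max.bounded_iff)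
  also have "\<dots> \<longleftrightarrow> R \<noteq> {} \<and> \<not> closed_rejects \<delta> m p R"
  proof
    assume "card R \<le> Max S \<and> 1 \<le> Max S"
    then have "I = R" "card I \<ge> 1"
      using I R card_seteq[of R I] by auto
    then show "R \<noteq> {} \<and> \<not> closed_rejects \<delta> m p R"
      using I by auto
  next
    assume "R \<noteq> {} \<and> \<not> closed_rejects \<delta> m p R"
    then have "card R \<in> S"
      unfolding S_def by blast
    moreover have "card R \<ge> 1"
      using R \<open>R \<noteq> {} \<and> _\<close> by (simp add: Suc_le_eq card_gt_0_iff)
    ultimately show "card R \<le> Max S \<and> 1 \<le> Max S"
      using Max_ge[OF S] by (meson order_trans)
  qed
  finally show ?thesis unfolding R_def .
qed

context pvalue_sample
begin

text \<open>The union bound for this event requires measurability. The random rejection set is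
  replaced by a union over its finitely many nonempty values.\<close>

lemma sets_simes_fdp_bound_ge_1:
  "{\<omega> \<in> space (sample m). simes_fdp_bound \<alpha> \<delta> m (pvals \<omega>) \<ge> 1} \<in> sets (sample m)"
proof -
  have "{\<omega> \<in> space (sample m). simes_fdp_bound \<alpha> \<delta> m (pvals \<omega>) \<ge> 1} =
      (\<Union>S \<in> Pow {1..m} - {{}}. {\<omega> \<in> space (sample m). bh_set \<alpha> m (pvals \<omega>) = S} \<inter>
        (space (sample m) - {\<omega> \<in> space (sample m). closed_rejects \<delta> m (pvals \<omega>) S}))"
  proof -
    have "bh_set \<alpha> m p \<in> Pow {1..m}" for p
      unfolding bh_set_def by auto
    then show ?thesis
      unfolding simes_fdp_bound_ge_1_iff by blast
  qed
  also have "\<dots> \<in> sets (sample m)"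
    using pred_bh_set_eq[OF measurable_pvals] pred_closed_rejects[OF measurable_pvals]
    by (intro sets.finite_UN sets.Int sets.Diff sets.top) (simp_all only: pred_def finite_Diff finite_Pow_iff finite_atLeastAtMost)
  finally show ?thesis .
qed

text \<open>Three events cover the space: the bound is at least 1 (\<open>B\<close>), Simes rejects
  the full set (\<open>E\<close>), or BH has few rejections (\<open>K\<close>). Hence
  \<open>1 \<le> P(B) + a * \<delta> + P(K)\<close>, and \<open>P(B)\<close> tending to 0 would give
  \<open>1 \<le> a * \<delta>\<close>.\<close>

lemma simes_fdp_bound_ge_1_not_tendsto_0:
  assumes "0 \<le> \<delta>" "\<delta> \<le> 1" "0 \<le> a" "a * \<delta> < 1" "0 \<le> c"
    and F: "\<And>t. t \<in> {0..1} \<Longrightarrow> measure C {x \<in> space C. snd x \<le> t} \<le> a * t"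
    and c: "(\<lambda>m. measure (sample m)
      {\<omega> \<in> space (sample m). real (bh_count \<alpha> m (pvals \<omega>)) \<le> real m * c}) \<longlonglongrightarrow> 0"
  shows "\<not> (\<lambda>m. measure (sample m)
      {\<omega> \<in> space (sample m). simes_fdp_bound \<alpha> \<delta> m (pvals \<omega>) \<ge> 1}) \<longlonglongrightarrow> 0"
proof
  define B where "B m = {\<omega> \<in> space (sample m). simes_fdp_bound \<alpha> \<delta> m (pvals \<omega>) \<ge> 1}" for m
  define E where "E m = {\<omega> \<in> space (sample m). simes_rejects \<delta> (pvals \<omega>) {1..m}}" for m
  define K where "K m = {\<omega> \<in> space (sample m). real (bh_count \<alpha> m (pvals \<omega>)) \<le> real m * c}" for m
  assume "(\<lambda>m. measure (sample m)
      {\<omega> \<in> space (sample m). simes_fdp_bound \<alpha> \<delta> m (pvals \<omega>) \<ge> 1}) \<longlonglongrightarrow> 0"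
  then have "(\<lambda>m. measure (sample m) (B m)) \<longlonglongrightarrow> 0"
    by (simp only: B_def)
  moreover have "(\<lambda>m. measure (sample m) (K m)) \<longlonglongrightarrow> 0"
    using c by (simp only: K_def)
  ultimately have "(\<lambda>m. measure (sample m) (B m) + a * \<delta> + measure (sample m) (K m)) \<longlonglongrightarrow> 0 + a * \<delta> + 0"
    by (intro tendsto_intros)
  moreover have "1 \<le> measure (sample m) (B m) + a * \<delta> + measure (sample m) (K m)" for m
  proof -
    interpret sample: prob_space "sample m" by (rule prob_space_sample)
    have "Measurable.pred (sample m) (\<lambda>\<omega>. real (bh_count \<alpha> m (pvals \<omega>)) \<le> real m * c)"
      by (rule measurable_compose[OF measurable_bh_count[OF measurable_pvals]]) (simp_all only: measurable_count_space)
    then have sets: "B m \<in> sets (sample m)" "E m \<in> sets (sample m)" "K m \<in> sets (sample m)"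
      using sets_simes_fdp_bound_ge_1 pred_simes_rejects[OF finite_atLeastAtMost measurable_pvals]
      by (simp_all only: B_def E_def K_def pred_def)
    have "space (sample m) \<subseteq> B m \<union> E m \<union> K m"
    proof
      fix \<omega> assume \<omega>: "\<omega> \<in> space (sample m)"
      show "\<omega> \<in> B m \<union> E m \<union> K m"
      proof (rule ccontr)
        assume not: "\<omega> \<notin> B m \<union> E m \<union> K m"
        have "real (bh_count \<alpha> m (pvals \<omega>)) > real m * c"
          using not \<omega> by (simp add: K_def)
        then have "bh_count \<alpha> m (pvals \<omega>) \<noteq> 0"
          using mult_nonneg_nonneg[OF of_nat_0_le_iff[of m] assms(5)] by (metis not_less of_nat_0)
        then have ne: "bh_set \<alpha> m (pvals \<omega>) \<noteq> {}"
          by (intro bh_set_nonempty) simp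
        have "bh_set \<alpha> m (pvals \<omega>) \<subseteq> {1..m}"
          unfolding bh_set_def by auto
        moreover have "\<not> simes_rejects \<delta> (pvals \<omega>) {1..m}"
          using not \<omega> by (simp add: E_def)
        ultimately have "\<not> closed_rejects \<delta> m (pvals \<omega>) (bh_set \<alpha> m (pvals \<omega>))"
          unfolding closed_rejects_def by blast
        with ne have "simes_fdp_bound \<alpha> \<delta> m (pvals \<omega>) \<ge> 1"
          by (simp only: simes_fdp_bound_ge_1_iff simp_thms)
        with not \<omega> show False by (simp add: B_def)
      qed
    qed
    then have "measure (sample m) (space (sample m)) \<le> measure (sample m) (B m \<union> E m \<union> K m)"
      using sets by (intro sample.finite_measure_mono) auto
    also have "\<dots> \<le> measure (sample m) (B m) + measure (sample m) (E m) + measure (sample m) (K m)"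
      using measure_Un_le[OF sets(1,2)] measure_Un_le[OF sets.Un[OF sets(1,2)] sets(3)] by linarith
    also have "measure (sample m) (E m) \<le> a * \<delta>"
      unfolding E_def using assms(1-3) F by (rule prob_simes_rejects_all_le)
    finally show ?thesis
      by (simp only: sample.prob_space)
  qed
  ultimately have "1 \<le> 0 + a * \<delta> + 0"
    by (intro LIMSEQ_le_const) auto
  with assms(4) show False by simp
qed

end

section \<open>The two-group model\<close>

lemma pvalue_sample_two_group_coord:
  assumes "real_distribution G"
  shows "pvalue_sample (two_group_coord \<pi>\<^sub>0 G)"
proof (rule pvalue_sample.intro)
  interpret G: real_distribution G by fact
  let ?U = "uniform_measure lborel {0..1::real}"
  let ?K = "count_space (UNIV :: bool set) \<Otimes>\<^sub>M (borel :: real measure)"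
  let ?N = "\<lambda>H::bool. distr (if H then ?U else G) ?K (\<lambda>x. (H, x))"
  have prob: "prob_space (?N H)" for H
  proof (rule prob_space.prob_space_distr)
    show "prob_space (if H then ?U else G)"
      using G.prob_space_axioms by (auto intro!: prob_space_uniform_measure)
    show "(\<lambda>x. (H, x)) \<in> measurable (if H then ?U else G) ?K"
      by (cases H) (auto intro!: measurable_Pair simp: measurable_cong_sets[of ?U borel ?K ?K]
          measurable_cong_sets[of G borel ?K ?K])
  qed
  have kernel: "?N \<in> measurable (measure_pmf (bernoulli_pmf \<pi>\<^sub>0)) (subprob_algebra ?K)"
    using prob by (auto simp add: space_subprob_algebra simp del: if_split intro!: prob_space_imp_subprob_space)
  show "prob_space (two_group_coord \<pi>\<^sub>0 G)"
    unfolding two_group_coord_def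
    by (rule measure_pmf.prob_space_bind[OF _ kernel]) (rule AE_I2, rule prob)
  have "sets (two_group_coord \<pi>\<^sub>0 G) = sets ?K"
    unfolding two_group_coord_def by (rule sets_bind[of _ _ ?K]) auto
  then show "snd \<in> borel_measurable (two_group_coord \<pi>\<^sub>0 G)"
    by (simp cong: measurable_cong_sets)
qed

lemma measure_two_group_coord:
  assumes "real_distribution G" "\<pi>\<^sub>0 \<in> {0<..<1}" "t \<in> {0..1}"
  shows "measure (two_group_coord \<pi>\<^sub>0 G) {x \<in> space (two_group_coord \<pi>\<^sub>0 G). snd x \<le> t}
    = \<pi>\<^sub>0 * t + (1 - \<pi>\<^sub>0) * cdf G t"
proof -
  interpret pvalue_sample "two_group_coord \<pi>\<^sub>0 G"
    by (rule pvalue_sample_two_group_coord) fact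
  have "{x \<in> space (two_group_coord \<pi>\<^sub>0 G). snd x \<le> t} = snd -` {..t} \<inter> space (two_group_coord \<pi>\<^sub>0 G)"
    by auto
  then show ?thesis
    using cdf_two_group_coord[OF assms] by (simp add: cdf_def measure_distr)
qed

section \<open>Linear bounds on the distribution function of \<open>G\<close>\<close>

lemma emeasure_density_atMost:
  fixes g :: "real \<Rightarrow> real"
  assumes "continuous_on {0..1} g" "t \<in> {0..1}"
  shows "emeasure (density lborel (\<lambda>x. ennreal (g x) * indicator {0..1} x)) {..t}
    = (\<integral>\<^sup>+ x. ennreal (g x) * indicator {0..t} x \<partial>lborel)"
proof -
  \<comment> \<open>Nothing is known about \<open>g\<close> outside \<open>{0..1}\<close>, so
    measurability is shown for its cut-off.\<close>
  have "(\<lambda>x. indicator {0..1} x *\<^sub>R g x) \<in> borel_measurable borel"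
    using assms(1) by (intro borel_measurable_continuous_on_indicator) auto
  then have "(\<lambda>x. ennreal (indicator {0..1} x *\<^sub>R g x)) \<in> borel_measurable lborel"
    by measurable
  also have "(\<lambda>x. ennreal (indicator {0..1} x *\<^sub>R g x)) = (\<lambda>x. ennreal (g x) * indicator {0..1} x)"
    by (auto simp: indicator_def)
  finally show ?thesis
    using assms(2) by (subst emeasure_density) (auto intro!: nn_integral_cong simp: indicator_def)
qed

lemma cdf_density_le:
  fixes g :: "real \<Rightarrow> real"
  assumes G: "G = density lborel (\<lambda>x. ennreal (g x) * indicator {0..1} x)" "prob_space G"
    and g: "continuous_on {0..1} g" and t: "t \<in> {0..1}"
    and b: "0 \<le> b" "\<And>x. x \<in> {0..t} \<Longrightarrow> g x \<le> b"
  shows "cdf G t \<le> b * t"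
proof -
  interpret prob_space G by fact
  have "emeasure G {..t} \<le> (\<integral>\<^sup>+ x. ennreal b * indicator {0..t} x \<partial>lborel)"
    unfolding G(1) emeasure_density_atMost[OF g t]
    using b(2) by (intro nn_integral_mono) (auto simp: indicator_def intro!: ennreal_leI)
  also have "\<dots> = ennreal (b * t)"
    using t b(1) by (simp add: nn_integral_cmult_indicator ennreal_mult)
  finally show ?thesis
    using b(1) t by (simp add: cdf_def emeasure_eq_measure)
qed

lemma cdf_density_ge:
  fixes g :: "real \<Rightarrow> real"
  assumes G: "G = density lborel (\<lambda>x. ennreal (g x) * indicator {0..1} x)" "prob_space G"
    and g: "continuous_on {0..1} g" and t: "t \<in> {0..1}"
    and b: "\<And>x. x \<in> {0..t} \<Longrightarrow> b \<le> g x"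
  shows "b * t \<le> cdf G t"
\<comment> \<open>\<open>ennreal\<close> truncates negative numbers to 0, so a negative
  \<open>b\<close> is treated apart; there the claim follows from nonnegativity of the distribution
  function.\<close>
proof (cases "0 \<le> b")
  case True
  interpret prob_space G by fact
  have "ennreal (b * t) = (\<integral>\<^sup>+ x. ennreal b * indicator {0..t} x \<partial>lborel)"
    using t True by (simp add: nn_integral_cmult_indicator ennreal_mult)
  also have "\<dots> \<le> emeasure G {..t}"
    unfolding G(1) emeasure_density_atMost[OF g t]
    using b by (intro nn_integral_mono) (auto simp: indicator_def intro!: ennreal_leI)
  finally show ?thesis
    by (simp add: cdf_def emeasure_eq_measure)
next
  case False
  then have "b * t \<le> 0"
    using t by (intro mult_nonpos_nonneg) auto
  then show ?thesis
    by (simp add: cdf_def order_trans[OF _ measure_nonneg])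
qed

theorem proposition17:
  fixes \<pi>\<^sub>0 \<alpha> \<delta> :: real and g :: "real \<Rightarrow> real" and G :: "real measure"
  assumes "0 < \<pi>\<^sub>0" and "\<pi>\<^sub>0 < 1"
    and "prob_space G"
    and "G = density lborel (\<lambda>x. ennreal (g x) * indicator {0..1} x)"
    and "\<forall>x\<in>{0..1}. g x \<ge> 0"
    and "continuous_on {0..1} g"
    and "antimono_on {0..1} g"
    and "0 < \<delta>"
    and "\<delta> < 1 / (\<pi>\<^sub>0 + (1 - \<pi>\<^sub>0) * g 0)"
    and "1 / (\<pi>\<^sub>0 + (1 - \<pi>\<^sub>0) * g 0) < \<alpha>"
    and "\<alpha> < 1"
  shows "\<not> bh_m_consistent \<pi>\<^sub>0 G \<alpha> (simes_fdp_bound \<alpha> \<delta>)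
       \<and> bh_m_consistent \<pi>\<^sub>0 G \<alpha> (dkw_fdp_bound \<alpha> \<delta>)
       \<and> bh_m_consistent \<pi>\<^sub>0 G \<alpha> (well_fdp_bound \<alpha> \<delta>)"
proof -
  define C where "C = two_group_coord \<pi>\<^sub>0 G"
  define a where "a = \<pi>\<^sub>0 + (1 - \<pi>\<^sub>0) * g 0"
  have g0: "g 0 \<ge> 0" using assms(5) by simp
  have a: "a > 0"
    unfolding a_def using assms(1,2) g0 by (intro add_pos_nonneg mult_nonneg_nonneg) auto
  have \<delta>: "\<delta> < 1 / a" and \<alpha>: "1 / a < \<alpha>"
    using assms(9,10) by (simp_all only: a_def)
  have \<alpha>0: "0 < \<alpha>" using a \<alpha> by (meson divide_pos_pos order_less_trans zero_less_one)
  have \<delta>1: "\<delta> \<le> 1" using \<delta> \<alpha> assms(11) by linarith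
  have a\<delta>: "a * \<delta> < 1" using \<delta> a by (simp add: less_divide_eq mult.commute)
  have G: "real_distribution G"
    unfolding real_distribution_def real_distribution_axioms_def using assms(3,4) by simp
  interpret pvalue_sample C
    unfolding C_def by (rule pvalue_sample_two_group_coord[OF G])
  have F: "measure C {x \<in> space C. snd x \<le> t} = \<pi>\<^sub>0 * t + (1 - \<pi>\<^sub>0) * cdf G t" if "t \<in> {0..1}" for t
    unfolding C_def using that assms(1,2) by (intro measure_two_group_coord G) auto
  have F_le: "measure C {x \<in> space C. snd x \<le> t} \<le> a * t" if t: "t \<in> {0..1}" for t
  proof -
    have "cdf G t \<le> g 0 * t"
      using t g0 monotone_onD[OF assms(7), of 0] by (intro cdf_density_le[OF assms(4,3,6)]) auto
    then have "(1 - \<pi>\<^sub>0) * cdf G t \<le> (1 - \<pi>\<^sub>0) * (g 0 * t)"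
      using assms(2) by (intro mult_left_mono) auto
    then show ?thesis
      unfolding F[OF t] a_def by (simp add: algebra_simps)
  qed
  obtain t where t: "t \<in> {0<..1}" "t / \<alpha> < measure C {x \<in> space C. snd x \<le> t}"
  proof -
    \<comment> \<open>Half the gap between the slope \<open>a\<close> and
      \<open>1 / \<alpha>\<close>: then \<open>a - \<eta>\<close> is
      \<open>1 / \<alpha> + \<eta>\<close>. Continuity at 0 keeps \<open>g\<close> above
      \<open>g 0 - \<eta>\<close> on \<open>{0..t}\<close>, hence
      \<open>F(t) \<ge> (a - \<eta>) * t > t / \<alpha>\<close>.\<close>
    define \<eta> where "\<eta> = (a - 1 / \<alpha>) / 2"
    have "1 < a * \<alpha>" using \<alpha> a by (simp add: divide_less_eq mult.commute)
    then have \<eta>: "\<eta> > 0" unfolding \<eta>_def using \<alpha>0 by (simp add: divide_less_eq)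
    obtain d where d: "d > 0" "\<And>x. x \<in> {0..1} \<Longrightarrow> dist x 0 < d \<Longrightarrow> dist (g x) (g 0) < \<eta>"
      using assms(6) \<eta> unfolding continuous_on_iff
      by (metis atLeastAtMost_iff order_refl zero_le_one)
    define t where "t = min (d / 2) 1"
    have t: "t \<in> {0<..1}" "t < d" using d(1) by (auto simp: t_def)
    have "(g 0 - \<eta>) * t \<le> cdf G t"
    proof (rule cdf_density_ge[OF assms(4,3,6)])
      fix x assume "x \<in> {0..t}"
      then have "dist (g x) (g 0) < \<eta>"
        using t by (intro d(2)) auto
      then show "g 0 - \<eta> \<le> g x"
        by (simp add: dist_real_def abs_less_iff)
    qed (use t in auto)
    then have "(1 - \<pi>\<^sub>0) * ((g 0 - \<eta>) * t) \<le> (1 - \<pi>\<^sub>0) * cdf G t"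
      using assms(2) by (intro mult_left_mono) auto
    moreover have "\<pi>\<^sub>0 * (\<eta> * t) > 0"
      using assms(1) \<eta> t by (intro mult_pos_pos) auto
    moreover have "a * t - \<eta> * t = t / \<alpha> + \<eta> * t"
      using \<alpha>0 by (simp add: \<eta>_def field_simps)
    moreover have "\<eta> * t > 0"
      using \<eta> t by simp
    moreover have "\<pi>\<^sub>0 * t + (1 - \<pi>\<^sub>0) * ((g 0 - \<eta>) * t) = a * t - \<eta> * t + \<pi>\<^sub>0 * (\<eta> * t)"
      by (simp add: a_def algebra_simps)
    ultimately have "t / \<alpha> < \<pi>\<^sub>0 * t + (1 - \<pi>\<^sub>0) * cdf G t"
      by linarith
    then show ?thesis
      using that[of t] t F[of t] by auto
  qed
  define c where "c = t / \<alpha>"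
  have c: "0 < c" using t \<alpha>0 by (simp add: c_def)
  have lim: "(\<lambda>m. measure (sample m)
      {\<omega> \<in> space (sample m). real (bh_count \<alpha> m (pvals \<omega>)) \<le> real m * c}) \<longlonglongrightarrow> 0"
    unfolding c_def using \<alpha>0 t(2) by (rule prob_bh_count_le_tendsto_0)
  have model: "two_group_model \<pi>\<^sub>0 G m = sample m" for m
    by (simp only: two_group_model_def C_def)
  \<comment> \<open>The tolerance \<open>\<epsilon> = 1 - \<alpha>\<close>, positive since
    \<open>\<alpha> < 1\<close>, turns the excess event into the event that the bound is at least
    1.\<close>
  have "1 - \<alpha> \<le> x - \<alpha> \<longleftrightarrow> 1 \<le> x" for x
    by linarith
  moreover have "\<not> (\<lambda>m. measure (sample m)
      {\<omega> \<in> space (sample m). simes_fdp_bound \<alpha> \<delta> m (pvals \<omega>) \<ge> 1}) \<longlonglongrightarrow> 0"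
    by (rule simes_fdp_bound_ge_1_not_tendsto_0[OF less_imp_le[OF assms(8)] \<delta>1 less_imp_le[OF a] a\<delta>
        less_imp_le[OF c] F_le lim])
  ultimately have "\<not> (\<lambda>m. measure (sample m)
      {\<omega> \<in> space (sample m). simes_fdp_bound \<alpha> \<delta> m (pvals \<omega>) - \<alpha> \<ge> 1 - \<alpha>}) \<longlonglongrightarrow> 0"
    by (simp only:) simp
  moreover have "1 - \<alpha> > 0" using assms(11) by simp
  ultimately have "\<not> bh_m_consistent \<pi>\<^sub>0 G \<alpha> (simes_fdp_bound \<alpha> \<delta>)"
    unfolding bh_m_consistent_def model by blast
  moreover have "bh_m_consistent \<pi>\<^sub>0 G \<alpha> (dkw_fdp_bound \<alpha> \<delta>)"
    unfolding bh_m_consistent_def model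
    using tendsto_prob_bound_excess[OF lim dkw_fdp_bound_eventually_less[OF assms(8) \<delta>1 c]] by blast
  moreover have "bh_m_consistent \<pi>\<^sub>0 G \<alpha> (well_fdp_bound \<alpha> \<delta>)"
    unfolding bh_m_consistent_def model
    using tendsto_prob_bound_excess[OF lim
        well_fdp_bound_eventually_less[OF assms(8) \<delta>1 \<alpha>0 less_imp_le[OF assms(11)] c]] by blast
  ultimately show ?thesis by blast
qed

end
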